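(* Let $u_N=(0,0,1)$ and $u_S=(0,0,-1)$ be the north and south pole of $\mathbb{S}^2$. The following configurations form hybrid designs on $\mathbb{S}^2$: (i) the circle $\{(x,y,z)\in\mathbb{S}^2: z=\frac13\}$ (traversed once), parallel to the equator at height $\frac13$, paired with the point set $\{u_S\}$ is a hybrid $2$-design with $\beta=\frac14$; (ii) the point set $\{u_S\}$ and a regular spherical triangle centered around the north pole $u_N$ at the correct height form a hybrid $2$-design; that is, there exists $a\in(0,\frac{\pi}{2})$ such that, with $\gamma_a$ the geodesic cycle through the three points $(\sin a,0,\cos a)$, $(-\frac12\sin a,\frac{\sqrt3}{2}\sin a,\cos a)$, $(-\frac12\sin a,-\frac{\sqrt3}{2}\sin a,\cos a)$, the pair $(\gamma_a,\{u_S\})$ is a hybrid $2$-design; (iii) the equator $\{(x,y,z)\in\mathbb{S}^2:z=0\}$ (traversed once) paired with the point set $\{u_N,u_S\}$ is a hybrid $3$-design with $\beta=\frac13$.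
   Context: $\int_{\mathbb{S}^2}$ is with respect to the normalized rotation-invariant measure on the unit sphere $\mathbb{S}^2\subseteq\mathbb{R}^3$; $\mathrm{Pol}_{\le t}$ is the space of real polynomials of total degree at most $t$ in $3$ variables restricted to $\mathbb{S}^2$. For a closed, continuous, piecewise smooth curve $\gamma$ on $\mathbb{S}^2$, $\int_\gamma p$ is the arc-length path integral and $\ell(\gamma)=\int_\gamma1$. A geodesic cycle through points $x_1,x_2,x_3$ is the closed curve consisting of the shortest great-circle arcs from $x_1$ to $x_2$, $x_2$ to $x_3$, and $x_3$ to $x_1$. For a closed curve $\gamma$ and a finite set $X\subseteq\mathbb{S}^2$, the pair $(\gamma,X)$ is a hybrid $t$-design if there is a constant $0\le\beta\le1$ (balancing factor) such that $\frac{\beta}{|X|}\sum_{x\in X}p(x)+\frac{1-\beta}{\ell(\gamma)}\int_\gamma p=\int_{\mathbb{S}^2}p$ for all $p\in\mathrm{Pol}_{\le t}$. *)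

theory Defs
  imports "HOL-Analysis.Analysis"
begin

abbreviation S2 :: "(real^3) set"
  where "S2 \<equiv> sphere 0 1"

text \<open>
  The normalized rotation-invariant measure on the unit sphere is constructed as the
  distribution of \<open>x / |x|\<close> for \<open>x\<close> uniformly distributed in the unit ball
  (\<open>sgn x = x / |x|\<close>; the value \<open>sgn 0 = 0\<close> off the sphere has probability \<open>0\<close>).
  The lemmas below establish normalization and rotation invariance.
\<close>
definition sphere_measure :: "(real^3) measure"
  where "sphere_measure =
    restrict_space (distr (uniform_measure lborel (ball 0 1)) borel sgn) S2"

lemma space_sphere_measure: "space sphere_measure = S2"
  by (simp add: sphere_measure_def space_restrict_space)

lemma sets_sphere_measure: "sets sphere_measure = sets (restrict_space borel S2)"
  by (simp add: sphere_measure_def sets_restrict_space)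

lemma measurable_sgn_vec [measurable]: "(sgn :: real^3 \<Rightarrow> real^3) \<in> borel_measurable borel"
proof -
  have "(\<lambda>x::real^3. x /\<^sub>R norm x) \<in> borel_measurable borel"
    by measurable
  then show ?thesis
    by (simp add: sgn_div_norm[abs_def])
qed

lemma emeasure_sphere_measure:
  assumes "A \<in> sets borel" "A \<subseteq> S2"
  shows "emeasure sphere_measure A =
    emeasure lborel (ball 0 1 \<inter> sgn -` A) / emeasure lborel (ball (0::real^3) 1)"
proof -
  have "sgn -` A \<in> sets (borel :: (real^3) measure)"
    using measurable_sets[OF measurable_sgn_vec assms(1)] by simp
  then show ?thesis
    unfolding sphere_measure_def using assms
    by (simp add: emeasure_restrict_space emeasure_distr)
qed

lemma emeasure_unit_ball:
  "emeasure lborel (ball (0::real^3) 1) \<noteq> 0" "emeasure lborel (ball (0::real^3) 1) \<noteq> \<infinity>"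
  using content_ball_pos[of 1 "0::real^3"] by (auto simp: emeasure_eq_ennreal_measure measure_def)

lemma sphere_measure_normalized: "emeasure sphere_measure S2 = 1"
proof -
  have *: "ball (0::real^3) 1 \<inter> sgn -` S2 = ball 0 1 - {0}"
    by (auto simp: norm_sgn split: if_splits)
  have "emeasure lborel (ball (0::real^3) 1 - {0}) = emeasure lborel (ball (0::real^3) 1)"
    by (subst emeasure_Diff) auto
  then show ?thesis
    using emeasure_unit_ball by (simp add: emeasure_sphere_measure * ennreal_divide_self less_top zero_less_iff_neq_zero)
qed

lemma sphere_measure_rotation_invariant:
  fixes T :: "real^3 \<Rightarrow> real^3"
  assumes T: "orthogonal_transformation T" and A: "A \<in> sets sphere_measure"
  shows "emeasure sphere_measure (T ` A) = emeasure sphere_measure A"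
proof -
  have A': "A \<in> sets borel" "A \<subseteq> S2"
    using A by (auto simp: sets_sphere_measure sets_restrict_space)
  have inj: "inj T" and surj: "surj T" and lin: "linear T" and nT: "\<And>x. norm (T x) = norm x"
    using T by (auto simp: orthogonal_transformation_inj orthogonal_transformation_surj
        orthogonal_transformation_linear orthogonal_transformation_norm)
  have TB: "T ` B \<in> sets borel" if "B \<in> sets borel" for B
  proof -
    have "linear (inv T)"
      using T by (simp add: orthogonal_transformation_inv orthogonal_transformation_linear)
    then have "inv T \<in> borel_measurable borel"
      by (intro borel_measurable_continuous_onI linear_continuous_on linear_conv_bounded_linear[THEN iffD1])
    from measurable_sets[OF this that] show ?thesis
      using inj surj bij_vimage_eq_inv_image[of "inv T" B]
      by (simp add: bij_def bij_imp_bij_inv inv_inv_eq surj_imp_inj_inv inj_imp_surj_inv)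
  qed
  have TS: "T ` A \<subseteq> S2"
    using A'(2) nT by auto
  have sgnT: "sgn (T x) = T (sgn x)" for x
    by (simp add: sgn_div_norm nT linear_cmul[OF lin])
  have eq: "ball 0 1 \<inter> sgn -` (T ` A) = T ` (ball 0 1 \<inter> sgn -` A)" (is "?L = ?R")
  proof
    show "?R \<subseteq> ?L" using nT by (auto simp: sgnT)
    show "?L \<subseteq> ?R"
    proof
      fix y assume y: "y \<in> ?L"
      obtain x where x: "y = T x" using surj by (metis surjD)
      with y have "T (sgn x) \<in> T ` A" by (simp add: sgnT)
      then have "sgn x \<in> A" using inj by (simp add: inj_image_mem_iff)
      then show "y \<in> ?R" using y x nT by auto
    qed
  qed
  have B: "ball 0 1 \<inter> sgn -` A \<in> sets (borel :: (real^3) measure)" (is "?B \<in> _")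
    using measurable_sets[OF measurable_sgn_vec A'(1)] by auto
  have Bl: "?B \<in> lmeasurable"
    by (rule bounded_set_imp_lmeasurable) (use B in \<open>auto intro: bounded_Int\<close>)
  have "emeasure lborel (T ` ?B) = emeasure lebesgue (T ` ?B)"
    using TB[OF B] by simp
  also have "\<dots> = emeasure lebesgue ?B"
    using measure_orthogonal_image[OF T Bl] measurable_orthogonal_image[OF T Bl] Bl
    by (simp add: emeasure_eq_measure2)
  also have "\<dots> = emeasure lborel ?B"
    using B by simp
  finally show ?thesis
    using A' TS TB by (simp add: emeasure_sphere_measure eq)
qed

text \<open>The space of real polynomials of total degree at most \<open>t\<close> in three variables, restricted to the
  sphere; \<open>restrict\<close> makes two polynomials agreeing on the sphere equal.\<close>
definition Pol :: "nat \<Rightarrow> (real^3 \<Rightarrow> real) set"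
  where "Pol t = {restrict (\<lambda>v. \<Sum>(i, j, k) \<in> {(i, j, k). i + j + k \<le> t}.
                      c i j k * (v$1)^i * (v$2)^j * (v$3)^k) S2
                   | c :: nat \<Rightarrow> nat \<Rightarrow> nat \<Rightarrow> real. True}"

lemma finite_monomials: "finite {(i, j, k). i + j + k \<le> (t::nat)}"
  by (rule finite_subset[of _ "{..t} \<times> {..t} \<times> {..t}"]) auto

text \<open>\<open>D n\<close> is the \<open>n\<close>-th derivative of \<open>\<gamma>\<close>, one-sided at the endpoints of the interval.\<close>
definition smooth_on_interval :: "(real \<Rightarrow> real^3) \<Rightarrow> real \<Rightarrow> real \<Rightarrow> bool"
  where "smooth_on_interval \<gamma> a b \<longleftrightarrow>
    (\<exists>D :: nat \<Rightarrow> real \<Rightarrow> real^3.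
       (\<forall>t \<in> {a..b}. D 0 t = \<gamma> t) \<and>
       (\<forall>n. \<forall>t \<in> {a..b}. (D n has_vector_derivative D (Suc n) t) (at t within {a..b})))"

text \<open>Smoothness is required on the closed pieces, unlike in \<^const>\<open>valid_path\<close>, where the
  derivative need not even be bounded near the breakpoints (so that the path may have
  infinite length).\<close>
definition piecewise_smooth :: "(real \<Rightarrow> real^3) \<Rightarrow> bool"
  where "piecewise_smooth \<gamma> \<longleftrightarrow>
    (\<exists>(s :: nat \<Rightarrow> real) m. s 0 = 0 \<and> s m = 1 \<and>
       (\<forall>i<m. s i < s (Suc i) \<and> smooth_on_interval \<gamma> (s i) (s (Suc i))))"

definition closed_curve_on_S2 :: "(real \<Rightarrow> real^3) \<Rightarrow> bool"
  where "closed_curve_on_S2 \<gamma> \<longleftrightarrow>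
    path \<gamma> \<and> pathfinish \<gamma> = pathstart \<gamma> \<and> path_image \<gamma> \<subseteq> S2 \<and> piecewise_smooth \<gamma>"

text \<open>The derivative may fail to exist at the finitely many breakpoints, which do not affect the
  integral.\<close>
definition path_integral :: "(real \<Rightarrow> real^3) \<Rightarrow> (real^3 \<Rightarrow> real) \<Rightarrow> real"
  where "path_integral \<gamma> p = integral {0..1} (\<lambda>t. p (\<gamma> t) * norm (vector_derivative \<gamma> (at t)))"

definition curve_length :: "(real \<Rightarrow> real^3) \<Rightarrow> real"
  where "curve_length \<gamma> = path_integral \<gamma> (\<lambda>_. 1)"

text \<open>Testing with \<open>p = 1\<close> shows that the convention \<open>x / 0 = 0\<close> is harmless here: an empty
  \<open>X\<close> forces \<open>\<beta> = 0\<close>, and a curve of length \<open>0\<close> forces \<open>\<beta> = 1\<close>.\<close>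
definition hybrid_design_with :: "nat \<Rightarrow> real \<Rightarrow> (real \<Rightarrow> real^3) \<Rightarrow> (real^3) set \<Rightarrow> bool"
  where "hybrid_design_with t \<beta> \<gamma> X \<longleftrightarrow>
    closed_curve_on_S2 \<gamma> \<and> finite X \<and> X \<subseteq> S2 \<and> 0 \<le> \<beta> \<and> \<beta> \<le> 1 \<and>
    (\<forall>p \<in> Pol t.
       \<beta> / real (card X) * (\<Sum>x\<in>X. p x) + (1 - \<beta>) / curve_length \<gamma> * path_integral \<gamma> p
         = integral\<^sup>L sphere_measure p)"

definition hybrid_design :: "nat \<Rightarrow> (real \<Rightarrow> real^3) \<Rightarrow> (real^3) set \<Rightarrow> bool"
  where "hybrid_design t \<gamma> X \<longleftrightarrow> (\<exists>\<beta>. hybrid_design_with t \<beta> \<gamma> X)"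

text \<open>The circle of latitude at height \<open>h\<close>, traversed once.\<close>
definition latitude_circle :: "real \<Rightarrow> real \<Rightarrow> real^3"
  where "latitude_circle h t =
    vector [sqrt (1 - h\<^sup>2) * cos (2 * pi * t), sqrt (1 - h\<^sup>2) * sin (2 * pi * t), h]"

lemma norm_vec3: "norm (v :: real^3) = sqrt ((v$1)\<^sup>2 + (v$2)\<^sup>2 + (v$3)\<^sup>2)"
  by (simp add: norm_vec_def L2_set_def sum_3)

lemma path_image_latitude_circle:
  assumes "\<bar>h\<bar> < 1"
  shows "path_image (latitude_circle h) = {v \<in> S2. v$3 = h}"
proof
  have h: "h\<^sup>2 < 1" using assms by (simp add: abs_square_less_1)
  show "path_image (latitude_circle h) \<subseteq> {v \<in> S2. v$3 = h}"
  proof -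
    have "(sqrt (1 - h\<^sup>2) * cos u)\<^sup>2 + (sqrt (1 - h\<^sup>2) * sin u)\<^sup>2 + h\<^sup>2 = 1" for u
    proof -
      have "(sqrt (1 - h\<^sup>2) * cos u)\<^sup>2 + (sqrt (1 - h\<^sup>2) * sin u)\<^sup>2
          = (1 - h\<^sup>2) * ((cos u)\<^sup>2 + (sin u)\<^sup>2)"
        using h by (simp only: power_mult_distrib distrib_left) simp
      then show ?thesis by simp
    qed
    then show ?thesis
      by (auto simp: path_image_def latitude_circle_def norm_vec3)
  qed
  show "{v \<in> S2. v$3 = h} \<subseteq> path_image (latitude_circle h)"
  proof
    fix v assume "v \<in> {v \<in> S2. v$3 = h}"
    then have v: "(v$1)\<^sup>2 + (v$2)\<^sup>2 = 1 - h\<^sup>2" "v$3 = h"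
      by (auto simp: norm_vec3)
    let ?r = "sqrt (1 - h\<^sup>2)"
    have r: "?r > 0" "?r\<^sup>2 = 1 - h\<^sup>2" using h by auto
    have "(v$1 / ?r)\<^sup>2 + (v$2 / ?r)\<^sup>2 = 1"
      using v r h by (simp add: power_divide flip: add_divide_distrib)
    then obtain u where u: "0 \<le> u" "u < 2 * pi" "v$1 / ?r = cos u" "v$2 / ?r = sin u"
      using sincos_total_2pi by metis
    have "v = latitude_circle h (u / (2 * pi))"
      using u(3,4) v(2) r(1) by (simp add: latitude_circle_def vec_eq_iff forall_3 field_simps)
    then show "v \<in> path_image (latitude_circle h)"
      using u(1,2) by (auto simp: path_image_def field_simps intro!: image_eqI)
  qed
qed

lemma latitude_circle_traversed_once:
  assumes "\<bar>h\<bar> < 1" "0 \<le> t" "t < 1" "0 \<le> t'" "t' < 1"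
    and "latitude_circle h t = latitude_circle h t'"
  shows "t = t'"
proof -
  have "sqrt (1 - h\<^sup>2) > 0" using assms(1) by (simp add: abs_square_less_1)
  with assms(6) have "cos (2 * pi * t) = cos (2 * pi * t')" "sin (2 * pi * t) = sin (2 * pi * t')"
    by (auto simp: latitude_circle_def vec_eq_iff forall_3)
  then obtain n :: int where "2 * pi * t = 2 * pi * t' + 2 * pi * of_int n"
    using sin_cos_eq_iff by (metis mult.commute mult.assoc)
  then have "2 * pi * t = 2 * pi * (t' + of_int n)" by (simp add: algebra_simps)
  then have n: "t = t' + of_int n" by simp
  with assms(2-5) have "real_of_int n < 1" "real_of_int n > -1" by linarith+
  then have "n = 0" by linarith
  with n show ?thesis by simp
qed

text \<open>
  The shortest great-circle arc from \<open>x\<close> to \<open>y\<close>, for non-antipodal \<open>x\<close> and \<open>y\<close> on the sphere: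
  \<open>arccos (x \<bullet> y)\<close> is the geodesic distance and \<open>sgn (y - (x \<bullet> y) x)\<close> the unit tangent vector
  at \<open>x\<close> pointing towards \<open>y\<close>. For \<open>x = y\<close> the arc is constant. For antipodal points there is
  no unique shortest arc, and the value leaves the sphere.
\<close>
definition geodesic_arc :: "real^3 \<Rightarrow> real^3 \<Rightarrow> real \<Rightarrow> real^3"
  where "geodesic_arc x y t =
    cos (t * arccos (x \<bullet> y)) *\<^sub>R x + sin (t * arccos (x \<bullet> y)) *\<^sub>R sgn (y - (x \<bullet> y) *\<^sub>R x)"

lemma geodesic_arc_endpoints:
  assumes "x \<in> S2" "y \<in> S2"
  shows "pathstart (geodesic_arc x y) = x" "pathfinish (geodesic_arc x y) = y"
proof -
  let ?c = "x \<bullet> y"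
  have xy: "x \<bullet> x = 1" "y \<bullet> y = 1"
    using assms by (auto simp: dot_square_norm)
  have c: "\<bar>?c\<bar> \<le> 1"
    using Cauchy_Schwarz_ineq2[of x y] assms by simp
  have "(norm (y - ?c *\<^sub>R x))\<^sup>2 = 1 - ?c\<^sup>2"
    unfolding power2_norm_eq_inner
    using xy by (simp add: inner_diff_left inner_diff_right inner_commute power2_eq_square)
  then have n: "norm (y - ?c *\<^sub>R x) = sqrt (1 - ?c\<^sup>2)"
    by (metis norm_ge_zero real_sqrt_unique)
  show "pathstart (geodesic_arc x y) = x"
    by (simp add: pathstart_def geodesic_arc_def)
  have "cos (arccos ?c) = ?c" "sin (arccos ?c) = sqrt (1 - ?c\<^sup>2)"
    using c by (auto simp: cos_arccos_abs sin_arccos_abs)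
  moreover have "norm v *\<^sub>R sgn v = v" for v :: "real^3"
    by (cases "v = 0") (simp_all add: sgn_div_norm)
  ultimately show "pathfinish (geodesic_arc x y) = y"
    using n by (metis add.commute diff_add_cancel geodesic_arc_def mult_1 pathfinish_def)
qed

definition geodesic_cycle :: "real^3 \<Rightarrow> real^3 \<Rightarrow> real^3 \<Rightarrow> real \<Rightarrow> real^3"
  where "geodesic_cycle x1 x2 x3 =
    geodesic_arc x1 x2 +++ geodesic_arc x2 x3 +++ geodesic_arc x3 x1"

definition north_pole :: "real^3" where "north_pole = vector [0, 0, 1]"

definition south_pole :: "real^3" where "south_pole = vector [0, 0, -1]"

end

theory Submission
  imports Defs
begin

text \<open>
  Both sides of the design identity are linear in the polynomial, so it suffices to compare the
  moments of the configuration with those of the sphere, one monomial \<open>x^i y^j z^k\<close> at a time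
  (\<open>hybrid_design_withI\<close>). On the sphere, reflections kill every monomial with an odd exponent, and
  permuting the coordinates shows that \<open>x\<^sup>2\<close>, \<open>y\<^sup>2\<close>, \<open>z\<^sup>2\<close> have the same mean; they sum to \<open>1\<close>, so
  each mean is \<open>1/3\<close>. Up to degree three there are no other moments (\<open>sphere_moment\<close>).

  The configurations are symmetric enough about the \<open>z\<close>-axis that the moments with an odd power
  of \<open>x\<close> or of \<open>y\<close> vanish and \<open>x\<^sup>2\<close> and \<open>y\<^sup>2\<close> have equal means. If \<open>A\<close> and \<open>B\<close> denote the means of
  \<open>z\<close> and \<open>z\<^sup>2\<close> along the curve, what remains for a design of strength two with the south pole is
  \<open>(1 - \<beta>) A = \<beta>\<close> and \<open>\<beta> + (1 - \<beta>) B = 1/3\<close>, that is, \<open>\<beta> = A / (1 + A)\<close> and \<open>2 A + 3 B = 1\<close>; the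
  condition on \<open>x\<^sup>2\<close> and \<open>y\<^sup>2\<close> then follows from \<open>x\<^sup>2 + y\<^sup>2 + z\<^sup>2 = 1\<close>. The circle at height \<open>1/3\<close>
  has \<open>A = 1/3\<close> and \<open>B = 1/9\<close>, hence \<open>\<beta> = 1/4\<close>. With the equator and both poles, all moments that
  are odd in \<open>z\<close> vanish, and \<open>\<beta> = 1/3\<close> is the value that gives \<open>z\<^sup>2\<close> its mean.

  For the triangle, every edge is written as \<open>cos u M + sin u D\<close> with \<open>\<bar>u\<bar> \<le> \<phi>\<close>, where \<open>M\<close> is its
  midpoint and \<open>D\<close> its horizontal unit direction. With \<open>Z\<close> the height of the midpoints, this gives
  \<open>A = sin \<phi> Z / \<phi>\<close> and \<open>B = (\<phi> + sin \<phi> cos \<phi>) Z\<^sup>2 / (2 \<phi>)\<close>. The half edge length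
  \<open>\<phi>\<close> is the convenient parameter: \<open>2 A + 3 B\<close> exceeds \<open>1\<close> at \<open>\<phi> = \<pi>/6\<close> and vanishes at
  \<open>\<phi> = \<pi>/3\<close>, where the triangle becomes the equator, so the value \<open>1\<close> is taken in between
  (\<open>exists_triangle_height\<close>).
\<close>

section \<open>Moments of the sphere\<close>

definition monomial :: "nat \<Rightarrow> nat \<Rightarrow> nat \<Rightarrow> real^3 \<Rightarrow> real"
  where "monomial i j k v = (v$1)^i * (v$2)^j * (v$3)^k"

lemma continuous_on_monomial: "continuous_on A (monomial i j k)"
  unfolding monomial_def[abs_def] by (intro continuous_intros)

lemma borel_measurable_sphere_measureI:
  assumes "f \<in> borel_measurable borel"
  shows "f \<in> borel_measurable sphere_measure"
  using measurable_restrict_space1[OF assms, of S2]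
  by (simp add: measurable_cong_sets[OF sets_sphere_measure refl])

lemma finite_measure_sphere_measure: "finite_measure sphere_measure"
  by (rule finite_measureI) (simp add: space_sphere_measure sphere_measure_normalized)

lemma measure_sphere_measure: "measure sphere_measure (space sphere_measure) = 1"
  by (simp add: space_sphere_measure measure_def sphere_measure_normalized)

lemma integrable_sphere_measure:
  assumes "continuous_on UNIV f"
  shows "integrable sphere_measure (f :: real^3 \<Rightarrow> real)"
proof -
  interpret finite_measure sphere_measure by (rule finite_measure_sphere_measure)
  have "compact (f ` S2)"
    by (intro compact_continuous_image continuous_on_subset[OF assms]) auto
  then obtain B where "\<forall>v\<in>S2. norm (f v) \<le> B"
    unfolding bounded_iff[symmetric] using compact_imp_bounded bounded_iff by (metis imageI)
  then show ?thesis
    using assms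
    by (intro integrable_const_bound[of _ B] AE_I2 borel_measurable_sphere_measureI
        borel_measurable_continuous_onI) (auto simp: space_sphere_measure)
qed

text \<open>
  Invariance is available for the measure of a set under taking images; the integral transforms by
  the image measure, which involves preimages. The two are linked by applying the former to the
  inverse of \<open>T\<close>, which is again orthogonal.
\<close>
lemma integral_sphere_measure_orthogonal:
  fixes f :: "real^3 \<Rightarrow> real"
  assumes T: "orthogonal_transformation T" and f: "f \<in> borel_measurable borel"
  shows "(\<integral>v. f (T v) \<partial>sphere_measure) = (\<integral>v. f v \<partial>sphere_measure)"
proof -
  have "T \<in> borel_measurable borel"
    using T by (intro borel_measurable_continuous_onI linear_continuous_on)
      (simp add: linear_conv_bounded_linear[symmetric] orthogonal_transformation_linear)
  then have Tm: "T \<in> measurable sphere_measure sphere_measure"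
    using T unfolding measurable_cong_sets[OF sets_sphere_measure sets_sphere_measure]
    by (intro measurable_restrict_space3)
      (auto simp: orthogonal_transformation_norm)
  have "distr sphere_measure sphere_measure T = sphere_measure"
  proof (rule measure_eqI)
    fix A assume "A \<in> sets (distr sphere_measure sphere_measure T)"
    then have A: "A \<in> sets sphere_measure" by simp
    then have sub: "A \<subseteq> S2"
      using sets.sets_into_space space_sphere_measure by blast
    have "v \<in> S2" if "T v \<in> A" for v
      using subsetD[OF sub that] by (simp add: orthogonal_transformation_norm[OF T])
    then have "T -` A \<inter> S2 = inv T ` A"
      using bij_vimage_eq_inv_image[OF orthogonal_transformation_bij[OF T], of A] by blast
    then show "emeasure (distr sphere_measure sphere_measure T) A = emeasure sphere_measure A"
      using A Tm sphere_measure_rotation_invariant[OF orthogonal_transformation_inv[OF T] A]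
      by (simp add: emeasure_distr space_sphere_measure)
  qed simp
  then show ?thesis
    using integral_distr[OF Tm borel_measurable_sphere_measureI[OF f]] by simp
qed

definition reflect :: "3 \<Rightarrow> real^3 \<Rightarrow> real^3"
  where "reflect n v = (\<chi> m. if m = n then - v$m else v$m)"

lemma orthogonal_transformation_reflect: "orthogonal_transformation (reflect n)"
  unfolding orthogonal_transformation
  by (auto intro!: linearI arg_cong[of _ _ sqrt] sum.cong simp: reflect_def vec_eq_iff norm_vec_def L2_set_def)

definition permute :: "(3 \<Rightarrow> 3) \<Rightarrow> real^3 \<Rightarrow> real^3"
  where "permute \<pi> v = (\<chi> m. v $ \<pi> m)"

lemma orthogonal_transformation_permute:
  assumes "bij \<pi>"
  shows "orthogonal_transformation (permute \<pi>)"
  unfolding orthogonal_transformation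
proof
  show "linear (permute \<pi>)"
    by (intro linearI) (simp_all add: permute_def vec_eq_iff)
  have "norm (permute \<pi> v) = norm v" for v
    using sum.reindex_bij_betw[OF assms, of "\<lambda>m. (norm (v $ m))\<^sup>2"]
    by (simp add: permute_def norm_vec_def L2_set_def)
  then show "\<forall>v. norm (permute \<pi> v) = norm v" ..
qed

lemma sphere_moment_odd:
  assumes "odd i \<or> odd j \<or> odd k"
  shows "(\<integral>v. monomial i j k v \<partial>sphere_measure) = 0"
proof -
  have zero: ?thesis if "\<And>v. monomial i j k (reflect n v) = - monomial i j k v" for n
    using integral_sphere_measure_orthogonal[OF orthogonal_transformation_reflect[of n],
        of "monomial i j k"] that continuous_on_monomial
    by (simp add: borel_measurable_continuous_onI)
  show ?thesis
    using assms
  proof (elim disjE)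
    assume "odd i" then show ?thesis by (intro zero[of 1]) (simp add: monomial_def reflect_def)
  next
    assume "odd j" then show ?thesis by (intro zero[of 2]) (simp add: monomial_def reflect_def)
  next
    assume "odd k" then show ?thesis by (intro zero[of 3]) (simp add: monomial_def reflect_def)
  qed
qed

text \<open>
  Swapping two coordinates shows that the mean does not depend on \<open>n\<close>, and the three means add up
  to the mean of \<open>x\<^sup>2 + y\<^sup>2 + z\<^sup>2 = 1\<close>.
\<close>
lemma sphere_second_moment: "(\<integral>v. (v$n)\<^sup>2 \<partial>sphere_measure) = 1/3"
proof -
  have int: "integrable sphere_measure (\<lambda>v. (v$m)\<^sup>2)" for m :: 3
    by (intro integrable_sphere_measure continuous_intros)
  have same: "(\<integral>v. (v$m)\<^sup>2 \<partial>sphere_measure) = (\<integral>v. (v$n)\<^sup>2 \<partial>sphere_measure)" for m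
    using integral_sphere_measure_orthogonal[OF
        orthogonal_transformation_permute[OF bij_transpose[of n m]], of "\<lambda>v. (v$n)\<^sup>2"]
    by (simp add: permute_def)
  have "(\<Sum>m\<in>UNIV. \<integral>v. (v$m)\<^sup>2 \<partial>sphere_measure) = (\<integral>v. (\<Sum>m\<in>UNIV. (v$m)\<^sup>2) \<partial>sphere_measure)"
    by (rule Bochner_Integration.integral_sum[symmetric]) (rule int)
  also have "\<dots> = (\<integral>v. 1 \<partial>sphere_measure)"
    by (rule Bochner_Integration.integral_cong) (auto simp: space_sphere_measure norm_vec3 sum_3)
  finally have "3 * (\<integral>v. (v$n)\<^sup>2 \<partial>sphere_measure) = measure sphere_measure (space sphere_measure)"
    by (simp add: sum_3 same[of 1] same[of 2] same[of 3])
  then show ?thesis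
    by (simp add: measure_sphere_measure)
qed

text \<open>
  Every exponent triple of degree at most three that is not covered by the odd case consists of
  zeros and at most one exponent two.
\<close>
lemma sphere_moment:
  assumes "i + j + k \<le> 3"
  shows "(\<integral>v. monomial i j k v \<partial>sphere_measure) =
    (if odd i \<or> odd j \<or> odd k then 0 else if i + j + k = 0 then 1 else 1/3)"
proof (cases "odd i \<or> odd j \<or> odd k")
  case False
  have even: "n = 0 \<or> n = 2" if "even n" "n \<le> 3" for n :: nat
    using that by presburger
  from False assms even[of i] even[of j] even[of k] consider "i = 0" "j = 0" "k = 0" | "i = 2" "j = 0" "k = 0"
    | "i = 0" "j = 2" "k = 0" | "i = 0" "j = 0" "k = 2"
    by auto
  then show ?thesis
    by cases (simp_all add: monomial_def measure_sphere_measure sphere_second_moment)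
qed (simp add: sphere_moment_odd)

section \<open>Arc-length integrals\<close>

text \<open>
  The relational form carries integrability along with the value, which makes it additive in \<open>p\<close>
  and under joining of curves.
\<close>
definition has_arclength_integral :: "(real \<Rightarrow> real^3) \<Rightarrow> (real^3 \<Rightarrow> real) \<Rightarrow> real \<Rightarrow> bool"
  where "has_arclength_integral \<gamma> p I \<longleftrightarrow>
    ((\<lambda>t. p (\<gamma> t) * norm (vector_derivative \<gamma> (at t))) has_integral I) {0..1}"

lemma path_integral_unique: "has_arclength_integral \<gamma> p I \<Longrightarrow> path_integral \<gamma> p = I"
  by (simp add: has_arclength_integral_def path_integral_def integral_unique)

lemma has_arclength_integral_sum:
  assumes "finite A" "\<And>a. a \<in> A \<Longrightarrow> has_arclength_integral \<gamma> (p a) (I a)"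
  shows "has_arclength_integral \<gamma> (\<lambda>v. \<Sum>a\<in>A. c a * p a v) (\<Sum>a\<in>A. c a * I a)"
  using has_integral_sum[OF assms(1), of "\<lambda>a t. c a * (p a (\<gamma> t) * norm (vector_derivative \<gamma> (at t)))"
      "\<lambda>a. c a * I a" "{0..1}"] assms(2)
  by (simp add: has_arclength_integral_def sum_distrib_right mult.assoc has_integral_mult_right)

text \<open>
  The design identity is linear in the polynomial, and monomials span. Choosing the exponents
  \<open>(0, 0, 0)\<close> identifies the length of the curve as \<open>I 0 0 0\<close>.
\<close>
lemma hybrid_design_withI:
  assumes \<gamma>: "closed_curve_on_S2 \<gamma>" and X: "finite X" "X \<subseteq> S2" and \<beta>: "0 \<le> \<beta>" "\<beta> \<le> 1"
    and I: "\<And>i j k. i + j + k \<le> t \<Longrightarrow> has_arclength_integral \<gamma> (monomial i j k) (I i j k)"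
    and eq: "\<And>i j k. i + j + k \<le> t \<Longrightarrow>
      \<beta> / real (card X) * (\<Sum>x\<in>X. monomial i j k x) + (1 - \<beta>) / I 0 0 0 * I i j k
        = (\<integral>v. monomial i j k v \<partial>sphere_measure)"
  shows "hybrid_design_with t \<beta> \<gamma> X"
  unfolding hybrid_design_with_def
proof (intro conjI ballI)
  fix p assume "p \<in> Pol t"
  define A where "A = {(i, j, k). i + j + k \<le> t}"
  have fin: "finite A" unfolding A_def by (rule finite_monomials)
  from \<open>p \<in> Pol t\<close> obtain c where p: "p = restrict (\<lambda>v. \<Sum>(i, j, k)\<in>A. c i j k * monomial i j k v) S2"
    by (auto simp: Pol_def A_def monomial_def mult.assoc)
  define q where "q = (\<lambda>v. \<Sum>a\<in>A. (case a of (i, j, k) \<Rightarrow> c i j k) * (case a of (i, j, k) \<Rightarrow> monomial i j k) v)"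
  have pq: "p v = q v" if "v \<in> S2" for v
    using that by (simp add: p q_def case_prod_beta)
  have len: "curve_length \<gamma> = I 0 0 0"
    using path_integral_unique[OF I[of 0 0 0]] by (simp add: curve_length_def monomial_def[abs_def])
  have "has_arclength_integral \<gamma> q (\<Sum>a\<in>A. (case a of (i, j, k) \<Rightarrow> c i j k) * (case a of (i, j, k) \<Rightarrow> I i j k))"
    unfolding q_def by (rule has_arclength_integral_sum[OF fin]) (auto simp: A_def I)
  moreover have "path_integral \<gamma> p = path_integral \<gamma> q"
    unfolding path_integral_def using \<gamma>
    by (intro integral_cong) (auto simp: closed_curve_on_S2_def path_image_def intro!: pq)
  ultimately have path: "path_integral \<gamma> p = (\<Sum>(i, j, k)\<in>A. c i j k * I i j k)"
    by (simp add: path_integral_unique case_prod_beta)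
  have points: "(\<Sum>x\<in>X. p x) = (\<Sum>(i, j, k)\<in>A. c i j k * (\<Sum>x\<in>X. monomial i j k x))"
  proof -
    have "(\<Sum>x\<in>X. p x) = (\<Sum>x\<in>X. q x)"
      using X by (intro sum.cong) (auto intro: pq)
    then show ?thesis
      unfolding q_def by (subst (asm) sum.swap) (simp add: sum_distrib_left case_prod_beta)
  qed
  have "integral\<^sup>L sphere_measure p = integral\<^sup>L sphere_measure q"
    by (rule Bochner_Integration.integral_cong) (auto simp: space_sphere_measure intro: pq)
  also have "\<dots> = (\<Sum>(i, j, k)\<in>A. c i j k * (\<integral>v. monomial i j k v \<partial>sphere_measure))"
    unfolding q_def
    by (subst Bochner_Integration.integral_sum)
      (auto simp: case_prod_beta intro!: integrable_mult_right integrable_sphere_measure continuous_on_monomial)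
  also have "\<dots> = (\<Sum>(i, j, k)\<in>A. c i j k *
      (\<beta> / real (card X) * (\<Sum>x\<in>X. monomial i j k x) + (1 - \<beta>) / I 0 0 0 * I i j k))"
    by (intro sum.cong refl) (auto simp: A_def simp flip: eq)
  finally show "\<beta> / real (card X) * (\<Sum>x\<in>X. p x) + (1 - \<beta>) / curve_length \<gamma> * path_integral \<gamma> p
      = integral\<^sup>L sphere_measure p"
    unfolding points path len
    by (simp add: sum_distrib_left sum.distrib case_prod_beta algebra_simps)
qed (rule \<gamma> X \<beta>)+

section \<open>Piecewise smooth curves\<close>

lemma smooth_on_interval_cong:
  assumes "smooth_on_interval f a b" "\<And>t. t \<in> {a..b} \<Longrightarrow> f t = g t"
  shows "smooth_on_interval g a b"
proof -
  from assms(1) obtain D where "\<forall>t\<in>{a..b}. D 0 t = f t"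
    and "\<forall>n. \<forall>t\<in>{a..b}. (D n has_vector_derivative D (Suc n) t) (at t within {a..b})"
    unfolding smooth_on_interval_def by auto
  with assms(2) show ?thesis
    unfolding smooth_on_interval_def by (intro exI[of _ D]) auto
qed

text \<open>
  Joining paths runs each of them at double speed; this lemma provides the chain rule for all
  derivatives at once.
\<close>
lemma smooth_on_interval_affine:
  assumes "smooth_on_interval g a b" "0 < m"
  shows "smooth_on_interval (\<lambda>t. g (m * t + c)) ((a - c) / m) ((b - c) / m)"
proof -
  from assms(1) obtain D where D: "\<forall>t\<in>{a..b}. D 0 t = g t"
    "\<forall>n. \<forall>t\<in>{a..b}. (D n has_vector_derivative D (Suc n) t) (at t within {a..b})"
    unfolding smooth_on_interval_def by auto
  let ?J = "{(a - c) / m..(b - c) / m}"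
  have J: "m * t + c \<in> {a..b}" if "t \<in> ?J" for t
    using that assms(2) by (auto simp: field_simps)
  have "((\<lambda>t. m ^ n *\<^sub>R D n (m * t + c)) has_vector_derivative m ^ Suc n *\<^sub>R D (Suc n) (m * t + c))
      (at t within ?J)" if "t \<in> ?J" for n t
  proof -
    have "((\<lambda>t. m * t + c) has_vector_derivative m) (at t within ?J)"
      by (auto intro!: derivative_eq_intros simp: has_real_derivative_iff_has_vector_derivative[symmetric])
    moreover have "(D n has_vector_derivative D (Suc n) (m * t + c)) (at (m * t + c) within (\<lambda>t. m * t + c) ` ?J)"
    proof (rule has_vector_derivative_within_subset)
      show "(D n has_vector_derivative D (Suc n) (m * t + c)) (at (m * t + c) within {a..b})"
        using D(2) J[OF that] by blast
      show "(\<lambda>t. m * t + c) ` ?J \<subseteq> {a..b}"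
        using J by blast
    qed
    ultimately have "(D n \<circ> (\<lambda>t. m * t + c) has_vector_derivative m *\<^sub>R D (Suc n) (m * t + c)) (at t within ?J)"
      by (rule vector_diff_chain_within)
    from has_vector_derivative_scaleR[OF DERIV_const this, of "m ^ n"] show ?thesis
      by (simp add: o_def mult.commute)
  qed
  with D(1) J show ?thesis
    unfolding smooth_on_interval_def
    by - (rule exI[of _ "\<lambda>n t. m ^ n *\<^sub>R D n (m * t + c)"]; simp)
qed

lemma piecewise_smooth_if_smooth:
  assumes "smooth_on_interval \<gamma> 0 1"
  shows "piecewise_smooth \<gamma>"
  unfolding piecewise_smooth_def
  using assms by (intro exI[of _ real] exI[of _ 1]) auto

text \<open>
  The partition of the join is the halved partition of \<open>f\<close> followed by the halved and shifted
  partition of \<open>g\<close>.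
\<close>
lemma piecewise_smooth_join:
  assumes "piecewise_smooth f" "piecewise_smooth g" and fg: "pathfinish f = pathstart g"
  shows "piecewise_smooth (f +++ g)"
proof -
  from assms(1) obtain s m where s: "s 0 = (0::real)" "s m = 1"
    and ss: "\<And>i. i < m \<Longrightarrow> s i < s (Suc i)" "\<And>i. i < m \<Longrightarrow> smooth_on_interval f (s i) (s (Suc i))"
    unfolding piecewise_smooth_def by blast
  from assms(2) obtain s' m' where s': "s' 0 = (0::real)" "s' m' = 1"
    and ss': "\<And>i. i < m' \<Longrightarrow> s' i < s' (Suc i)" "\<And>i. i < m' \<Longrightarrow> smooth_on_interval g (s' i) (s' (Suc i))"
    unfolding piecewise_smooth_def by blast
  have le1: "s i \<le> 1" if "i \<le> m" for i
    using that
  proof (induction rule: inc_induct)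
    case (step n)
    then show ?case using ss(1)[of n] by simp
  qed (simp add: s)
  have ge0: "0 \<le> s' i" if "i \<le> m'" for i
    using that
  proof (induction i)
    case (Suc n)
    then show ?case using ss'(1)[of n] by simp
  qed (simp add: s')
  define r where "r i = (if i \<le> m then s i / 2 else (s' (i - m) + 1) / 2)" for i
  have "smooth_on_interval (f +++ g) (r i) (r (Suc i)) \<and> r i < r (Suc i)" if "i < m + m'" for i
  proof (cases "i < m")
    case True
    have "smooth_on_interval (f +++ g) ((s i - 0) / 2) ((s (Suc i) - 0) / 2)"
      using le1[of "Suc i"] True
      by (intro smooth_on_interval_cong[OF smooth_on_interval_affine[OF ss(2)[OF True]]])
        (auto simp: joinpaths_def)
    then show ?thesis
      using True ss(1)[OF True] by (simp add: r_def)
  next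
    case False
    define i' where "i' = i - m"
    have i': "i' < m'" "i = m + i'" using that False by (auto simp: i'_def)
    (* At t = 1/2 the join takes its value from f, so this is where f and g have to fit together. *)
    have second: "g (2 * t + (-1)) = (f +++ g) t" if "1/2 \<le> t" for t
    proof (cases "t = 1/2")
      case True
      show ?thesis
        unfolding True using fg by (simp add: joinpaths_def pathfinish_def pathstart_def)
    qed (use that in \<open>simp add: joinpaths_def\<close>)
    have "smooth_on_interval (f +++ g) ((s' i' - (-1)) / 2) ((s' (Suc i') - (-1)) / 2)"
      using ge0[of i'] i'(1)
      by (intro smooth_on_interval_cong[OF smooth_on_interval_affine[OF ss'(2)[OF i'(1)]] second]) auto
    then show ?thesis
      using i' ss'(1)[OF i'(1)] s s' by (auto simp: r_def)
  qed
  moreover have "m' \<noteq> 0"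
    using s' by (cases m') auto
  then have "r 0 = 0" "r (m + m') = 1"
    using s s' by (auto simp: r_def)
  ultimately show ?thesis
    unfolding piecewise_smooth_def by blast
qed

text \<open>
  The exceptional set consists of the breakpoints. It is what allows the one-sided derivatives on
  the pieces to be replaced by the two-sided derivative inside arc-length integrals.
\<close>
lemma piecewise_smooth_differentiable:
  assumes "piecewise_smooth \<gamma>"
  obtains S where "finite S" "\<And>t. t \<in> {0..1} - S \<Longrightarrow> \<gamma> differentiable (at t)"
proof -
  from assms obtain s m where s: "s 0 = (0::real)" "s m = 1"
    and smooth: "\<And>i. i < m \<Longrightarrow> smooth_on_interval \<gamma> (s i) (s (Suc i))"
    unfolding piecewise_smooth_def by blast
  define S where "S = s ` {..m}"
  have "\<gamma> differentiable (at t)" if "k \<le> m" "t \<in> {0..s k} - S" for k t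
    using that
  proof (induction k)
    case 0
    then have "t = s 0" by (simp add: s)
    with 0 show ?case by (auto simp: S_def)
  next
    case (Suc k)
    show ?case
    proof (cases "t \<le> s k")
      case True
      then show ?thesis using Suc by auto
    next
      case False
      have "t \<noteq> s (Suc k)" using Suc.prems by (auto simp: S_def)
      then have t: "s k < t" "t < s (Suc k)" using False Suc.prems by auto
      from smooth[of k] Suc.prems(1) obtain D where D: "\<forall>t\<in>{s k..s (Suc k)}. D 0 t = \<gamma> t"
        "\<forall>n. \<forall>t\<in>{s k..s (Suc k)}. (D n has_vector_derivative D (Suc n) t) (at t within {s k..s (Suc k)})"
        unfolding smooth_on_interval_def by auto
      have "(D 0 has_vector_derivative D (Suc 0) t) (at t within {s k..s (Suc k)})"
        using D(2) t by auto
      then have "(D 0 has_vector_derivative D (Suc 0) t) (at t)"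
        using t by (simp add: at_within_Icc_at)
      then have "(\<gamma> has_vector_derivative D (Suc 0) t) (at t)"
        by (rule has_vector_derivative_transform_within_open[where S = "{s k<..<s (Suc k)}"])
          (use D(1) t in auto)
      then show ?thesis by (rule differentiableI_vector)
    qed
  qed
  from this[of m] s have "\<And>t. t \<in> {0..1} - S \<Longrightarrow> \<gamma> differentiable (at t)" by simp
  moreover have "finite S" by (simp add: S_def)
  ultimately show ?thesis using that by blast
qed

lemma vector_derivative_affine:
  fixes g :: "real \<Rightarrow> real^3"
  assumes "g differentiable (at (m * t + c))"
  shows "((\<lambda>t. g (m * t + c)) has_vector_derivative m *\<^sub>R vector_derivative g (at (m * t + c))) (at t)"
proof -
  have "((\<lambda>t. m * t + c) has_vector_derivative m) (at t)"
    by (auto intro!: derivative_eq_intros simp: has_real_derivative_iff_has_vector_derivative[symmetric])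
  then show ?thesis
    using vector_diff_chain_at[of "\<lambda>t. m * t + c" m t g] assms
    by (simp add: o_def vector_derivative_works)
qed

text \<open>
  Arc length does not depend on the parametrization: doubling the speed on each half cancels the
  factor from the substitution. The finitely many points at which a derivative may fail to exist
  are a null set.
\<close>
lemma has_arclength_integral_join:
  assumes smooth: "piecewise_smooth f" "piecewise_smooth g"
    and int: "has_arclength_integral f p I" "has_arclength_integral g p J"
  shows "has_arclength_integral (f +++ g) p (I + J)"
proof -
  define h where "h \<gamma> t = p (\<gamma> t) * norm (vector_derivative \<gamma> (at t))" for \<gamma> t
  (* Both halves are the same substitution: the shift is c = 0 for f and c = -1 for g. *)
  have half: "(h (f +++ g) has_integral K) {-c/2..(1-c)/2}"
    if \<gamma>: "piecewise_smooth \<gamma>" "(h \<gamma> has_integral K) {0..1}"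
      and eq: "\<And>t. t \<in> {-c/2<..<(1-c)/2} \<Longrightarrow> (f +++ g) t = \<gamma> (2 * t + c)" for \<gamma> K c
  proof -
    from \<gamma>(1) obtain S where S: "finite S" "\<And>t. t \<in> {0..1} - S \<Longrightarrow> \<gamma> differentiable (at t)"
      by (rule piecewise_smooth_differentiable) blast
    define S' where "S' = insert (-c/2) (insert ((1-c)/2) ((\<lambda>t. 2 * t + c) -` S))"
    have "finite S'"
      unfolding S'_def using S(1) by (simp add: finite_vimageI inj_on_def)
    moreover have "h (f +++ g) t = 2 * h \<gamma> (2 * t + c)" if "t \<in> {-c/2..(1-c)/2} - S'" for t
    proof -
      have t: "t \<in> {-c/2<..<(1-c)/2}" "2 * t + c \<in> {0..1} - S"
        using that by (auto simp: S'_def field_simps)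
      have "((\<lambda>t. \<gamma> (2 * t + c)) has_vector_derivative 2 *\<^sub>R vector_derivative \<gamma> (at (2 * t + c))) (at t)"
        by (rule vector_derivative_affine[OF S(2)[OF t(2)]])
      then have "((f +++ g) has_vector_derivative 2 *\<^sub>R vector_derivative \<gamma> (at (2 * t + c))) (at t)"
        by (rule has_vector_derivative_transform_within_open[where S = "{-c/2<..<(1-c)/2}"])
          (use t eq in auto)
      then show ?thesis
        using eq[OF t(1)] by (simp add: h_def vector_derivative_at)
    qed
    moreover have "((\<lambda>t. 2 * h \<gamma> (2 * t + c)) has_integral K) {-c/2..(1-c)/2}"
      using has_integral_mult_right[OF has_integral_affinity'[of "h \<gamma>" K 0 1 2 c], of 2] \<gamma>(2)
      by (simp add: field_simps)
    ultimately show ?thesis by (rule has_integral_spike_finite)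
  qed
  have fg: "(h f has_integral I) {0..1}" "(h g has_integral J) {0..1}"
    using int by (simp_all add: h_def[abs_def] has_arclength_integral_def)
  have "(h (f +++ g) has_integral I) {0..1/2}"
    using half[OF smooth(1) fg(1), of 0] by (simp add: joinpaths_def)
  moreover have "(h (f +++ g) has_integral J) {1/2..1}"
    using half[OF smooth(2) fg(2), of "-1"] by (simp add: joinpaths_def)
  ultimately have "(h (f +++ g) has_integral I + J) {0..1}"
    by (rule has_integral_combine[rotated 2]) auto
  then show ?thesis by (simp add: h_def[abs_def] has_arclength_integral_def)
qed

section \<open>Circular arcs\<close>

lemma has_vector_derivative_circular:
  fixes A B C :: "real^3"
  shows "((\<lambda>t. C + cos (\<alpha> * t + \<beta>) *\<^sub>R A + sin (\<alpha> * t + \<beta>) *\<^sub>R B) has_vector_derivative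
    \<alpha> *\<^sub>R (cos (\<alpha> * t + \<beta>) *\<^sub>R B - sin (\<alpha> * t + \<beta>) *\<^sub>R A)) (at t within T)"
  by (auto intro!: derivative_eq_intros simp: algebra_simps)

text \<open>
  Differentiating cosine and sine advances the angle by a quarter turn, which gives the derivatives
  of all orders in closed form.
\<close>
lemma smooth_on_interval_circular:
  "smooth_on_interval (\<lambda>t. C + cos (\<alpha> * t + \<beta>) *\<^sub>R A + sin (\<alpha> * t + \<beta>) *\<^sub>R B) a b"
proof -
  define D where "D n t = (if n = 0 then C else 0) +
    cos (\<alpha> * t + (\<beta> + real n * (pi/2))) *\<^sub>R (\<alpha> ^ n *\<^sub>R A) +
    sin (\<alpha> * t + (\<beta> + real n * (pi/2))) *\<^sub>R (\<alpha> ^ n *\<^sub>R B)" for n t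
  have "(D n has_vector_derivative D (Suc n) t) (at t within {a..b})" for n t
  proof -
    let ?u = "\<alpha> * t + (\<beta> + real n * (pi/2))"
    have u: "\<alpha> * t + (\<beta> + real (Suc n) * (pi/2)) = ?u + pi/2"
      by (simp add: algebra_simps add_divide_distrib)
    have "D (Suc n) t = \<alpha> *\<^sub>R (cos ?u *\<^sub>R (\<alpha> ^ n *\<^sub>R B) - sin ?u *\<^sub>R (\<alpha> ^ n *\<^sub>R A))"
      unfolding D_def u by (simp add: cos_add sin_add algebra_simps)
    then show ?thesis
      unfolding D_def[of n, abs_def] by (simp only: has_vector_derivative_circular)
  qed
  then show ?thesis
    unfolding smooth_on_interval_def by (intro exI[of _ D]) (simp add: D_def)
qed

lemma norm_circular:
  fixes A B :: "real^3"
  assumes "A \<bullet> B = 0" "norm A = r" "norm B = r"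
  shows "norm (cos u *\<^sub>R A + sin u *\<^sub>R B) = r"
proof -
  have AB: "A \<bullet> A = r\<^sup>2" "B \<bullet> B = r\<^sup>2" "B \<bullet> A = 0"
    using assms by (auto simp: dot_square_norm inner_commute)
  have "(norm (cos u *\<^sub>R A + sin u *\<^sub>R B))\<^sup>2 = (cos u)\<^sup>2 * r\<^sup>2 + (sin u)\<^sup>2 * r\<^sup>2"
    unfolding power2_norm_eq_inner
    by (simp add: inner_add_left inner_add_right AB assms(1) power2_eq_square algebra_simps)
  then have "(norm (cos u *\<^sub>R A + sin u *\<^sub>R B))\<^sup>2 = r\<^sup>2"
    by (simp flip: distrib_right)
  moreover have "0 \<le> r" using assms(2) by auto
  ultimately show ?thesis by (metis norm_ge_zero power2_eq_imp_eq)
qed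

text \<open>
  For orthogonal \<open>A\<close>, \<open>B\<close> of equal length \<open>r\<close> the curve is an arc of a circle of radius \<open>r\<close>, traversed
  with constant speed; the integral is thereby expressed by the angle \<open>u\<close>. Circles of latitude and
  geodesic arcs are both of this form.
\<close>
lemma has_arclength_integral_circular:
  assumes orth: "A \<bullet> B = 0" "norm A = r" "norm B = r" and \<alpha>: "0 < \<alpha>"
    and int: "((\<lambda>u. p (C + cos u *\<^sub>R A + sin u *\<^sub>R B)) has_integral I) {\<beta>..\<alpha> + \<beta>}"
  shows "has_arclength_integral (\<lambda>t. C + cos (\<alpha> * t + \<beta>) *\<^sub>R A + sin (\<alpha> * t + \<beta>) *\<^sub>R B) p (r * I)"
proof -
  have speed: "norm (\<alpha> *\<^sub>R (cos u *\<^sub>R B - sin u *\<^sub>R A)) = \<alpha> * r" for u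
    using norm_circular[of B "- A" r u] orth \<alpha> by (simp add: inner_commute)
  have "((\<lambda>t. (\<alpha> * r) * p (C + cos (\<alpha> * t + \<beta>) *\<^sub>R A + sin (\<alpha> * t + \<beta>) *\<^sub>R B)) has_integral (\<alpha> * r) * (I / \<alpha>)) {0..1}"
    using has_integral_affinity'[of "\<lambda>u. p (C + cos u *\<^sub>R A + sin u *\<^sub>R B)" I \<beta> "\<alpha> + \<beta>" \<alpha> \<beta>] int \<alpha>
    by (intro has_integral_mult_right) (simp add: divide_inverse mult.commute)
  then show ?thesis
    unfolding has_arclength_integral_def vector_derivative_at[OF has_vector_derivative_circular] speed
    using \<alpha> by (simp add: mult.commute)
qed

section \<open>Circles of latitude\<close>

lemma pole_monomial: "monomial i j k (vector [0, 0, z]) = (if i + j = 0 then z ^ k else 0)"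
  by (auto simp: monomial_def zero_power)

definition circle_mean :: "nat \<Rightarrow> nat \<Rightarrow> real"
  where "circle_mean i j = (if odd i \<or> odd j then 0 else if i + j = 0 then 1 else 1/2)"

text \<open>
  All cases have elementary antiderivatives: a single factor cosine or sine is the derivative of the
  other function, and the pure squares and cubes reduce to that by \<open>sin\<^sup>2 + cos\<^sup>2 = 1\<close> or to the
  half-angle primitives.
\<close>
lemma has_integral_circle_mean:
  assumes "i + j \<le> 3"
  shows "((\<lambda>u. cos u ^ i * sin u ^ j) has_integral 2 * pi * circle_mean i j) {0..2 * pi}"
proof -
  have ftc: "(f has_integral F (2 * pi) - F 0) {0..2 * pi}"
    if "\<And>u. (F has_real_derivative f u) (at u)" for F f :: "real \<Rightarrow> real"
    using that
    by (intro fundamental_theorem_of_calculus)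
      (auto simp flip: has_real_derivative_iff_has_vector_derivative intro: has_field_derivative_at_within)
  have cos2: "1 - (sin u)\<^sup>2 = (cos u)\<^sup>2" for u :: real
    by (simp add: cos_squared_eq)
  from assms consider "i = 0" "j = 0" | "i = 1" | "j = 1" | "i = 2" "j = 0" | "i = 0" "j = 2"
    | "i = 3" "j = 0" | "i = 0" "j = 3"
    by linarith
  then show ?thesis
  proof cases
    case 1
    then show ?thesis
      using ftc[of "\<lambda>u. u" "\<lambda>u. 1"] by (simp add: circle_mean_def)
  next
    case 2
    have "((\<lambda>u. sin u ^ Suc j / (1 + real j)) has_real_derivative cos u * sin u ^ j) (at u)" for u
      by (rule derivative_eq_intros refl | simp)+
    from ftc[OF this] 2 show ?thesis by (simp add: circle_mean_def)
  next
    case 3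
    have "((\<lambda>u. - (cos u ^ Suc i) / (1 + real i)) has_real_derivative cos u ^ i * sin u) (at u)" for u
      by (rule derivative_eq_intros refl | simp)+
    from ftc[OF this] 3 show ?thesis by (simp add: circle_mean_def)
  next
    case 4
    have "((\<lambda>u. (u + sin u * cos u) / 2) has_real_derivative (cos u)\<^sup>2) (at u)" for u :: real
      by (rule derivative_eq_intros refl | simp add: power2_eq_square[symmetric] sin_squared_eq)+
    from ftc[OF this] 4 show ?thesis by (simp add: circle_mean_def)
  next
    case 5
    have "((\<lambda>u. (u - sin u * cos u) / 2) has_real_derivative (sin u)\<^sup>2) (at u)" for u :: real
      by (rule derivative_eq_intros refl | simp add: power2_eq_square[symmetric] cos_squared_eq)+
    from ftc[OF this] 5 show ?thesis by (simp add: circle_mean_def)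
  next
    case 6
    have "((\<lambda>u. sin u - sin u ^ 3 / 3) has_real_derivative cos u * (1 - (sin u)\<^sup>2)) (at u)" for u :: real
      by (rule derivative_eq_intros refl | simp add: algebra_simps)+
    from ftc[OF this[unfolded cos2]] 6 show ?thesis
      by (simp add: circle_mean_def power3_eq_cube power2_eq_square mult.assoc)
  next
    case 7
    have "((\<lambda>u. cos u ^ 3 / 3 - cos u) has_real_derivative sin u * (1 - (cos u)\<^sup>2)) (at u)" for u :: real
      by (rule derivative_eq_intros refl | simp add: algebra_simps)+
    from ftc[OF this[folded sin_squared_eq]] 7 show ?thesis
      by (simp add: circle_mean_def power3_eq_cube power2_eq_square mult.assoc)
  qed
qed

lemma latitude_circle_eq:
  "latitude_circle h = (\<lambda>t. vector [0, 0, h] + cos (2 * pi * t + 0) *\<^sub>R vector [sqrt (1 - h\<^sup>2), 0, 0]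
    + sin (2 * pi * t + 0) *\<^sub>R vector [0, sqrt (1 - h\<^sup>2), 0])"
  by (rule ext) (simp add: latitude_circle_def vec_eq_iff forall_3 mult.commute)

lemma closed_curve_latitude_circle:
  assumes "\<bar>h\<bar> < 1"
  shows "closed_curve_on_S2 (latitude_circle h)"
  unfolding closed_curve_on_S2_def
proof (intro conjI)
  show "path (latitude_circle h)"
    unfolding path_def latitude_circle_eq by (intro continuous_intros)
  show "pathfinish (latitude_circle h) = pathstart (latitude_circle h)"
    by (simp add: pathfinish_def pathstart_def latitude_circle_def)
  show "path_image (latitude_circle h) \<subseteq> S2"
    using path_image_latitude_circle[OF assms] by auto
  show "piecewise_smooth (latitude_circle h)"
    unfolding latitude_circle_eq by (intro piecewise_smooth_if_smooth smooth_on_interval_circular)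
qed

lemma has_arclength_integral_latitude_circle:
  fixes h :: real
  defines "r \<equiv> sqrt (1 - h\<^sup>2)"
  assumes h: "\<bar>h\<bar> < 1" and ij: "i + j \<le> 3"
  shows "has_arclength_integral (latitude_circle h) (monomial i j k)
    (2 * pi * r * (r ^ (i + j) * h ^ k * circle_mean i j))"
proof -
  have r: "0 < r" using h by (simp add: r_def abs_square_less_1)
  have "((\<lambda>u. (r ^ (i + j) * h ^ k) * (cos u ^ i * sin u ^ j)) has_integral
      (r ^ (i + j) * h ^ k) * (2 * pi * circle_mean i j)) {0..2 * pi}"
    by (intro has_integral_mult_right has_integral_circle_mean ij)
  then have "((\<lambda>u. monomial i j k (vector [0, 0, h] + cos u *\<^sub>R vector [r, 0, 0] + sin u *\<^sub>R vector [0, r, 0]))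
      has_integral (r ^ (i + j) * h ^ k) * (2 * pi * circle_mean i j)) {0..2 * pi + 0}"
    by (simp add: monomial_def power_mult_distrib power_add mult_ac)
  then have "has_arclength_integral (latitude_circle h) (monomial i j k)
      (r * ((r ^ (i + j) * h ^ k) * (2 * pi * circle_mean i j)))"
    unfolding latitude_circle_eq r_def[symmetric] using r
    by (intro has_arclength_integral_circular) (simp_all add: norm_vec3 inner_vec_def sum_3)
  then show ?thesis by (simp add: mult_ac)
qed

text \<open>
  Dividing by the length \<open>2 \<pi> sqrt (1 - h\<^sup>2)\<close> turns the criterion into a finite table of identities
  between numbers.
\<close>
lemma hybrid_design_latitude_circle:
  assumes h: "\<bar>h\<bar> < 1" and t: "t \<le> 3" and X: "finite X" "X \<subseteq> S2" and \<beta>: "0 \<le> \<beta>" "\<beta> \<le> 1"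
    and eq: "\<And>i j k. i + j + k \<le> t \<Longrightarrow>
      \<beta> / real (card X) * (\<Sum>x\<in>X. monomial i j k x)
        + (1 - \<beta>) * (sqrt (1 - h\<^sup>2) ^ (i + j) * h ^ k * circle_mean i j)
      = (if odd i \<or> odd j \<or> odd k then 0 else if i + j + k = 0 then 1 else 1/3)"
  shows "hybrid_design_with t \<beta> (latitude_circle h) X"
proof (rule hybrid_design_withI[OF closed_curve_latitude_circle[OF h] X \<beta>])
  fix i j k :: nat
  assume ijk: "i + j + k \<le> t"
  then show "has_arclength_integral (latitude_circle h) (monomial i j k)
    (2 * pi * sqrt (1 - h\<^sup>2) * (sqrt (1 - h\<^sup>2) ^ (i + j) * h ^ k * circle_mean i j))"
    using t by (intro has_arclength_integral_latitude_circle h) simp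
  have "sqrt (1 - h\<^sup>2) > 0" using h by (simp add: abs_square_less_1)
  then show "\<beta> / real (card X) * (\<Sum>x\<in>X. monomial i j k x)
      + (1 - \<beta>) / (2 * pi * sqrt (1 - h\<^sup>2) * (sqrt (1 - h\<^sup>2) ^ (0 + 0) * h ^ 0 * circle_mean 0 0))
        * (2 * pi * sqrt (1 - h\<^sup>2) * (sqrt (1 - h\<^sup>2) ^ (i + j) * h ^ k * circle_mean i j))
    = (\<integral>v. monomial i j k v \<partial>sphere_measure)"
    using eq[OF ijk] sphere_moment[of i j k] ijk t by (simp add: circle_mean_def[of 0 0])
qed

lemma poles_in_S2: "{north_pole, south_pole} \<subseteq> S2"
  by (simp add: north_pole_def south_pole_def norm_vec3)

lemma latitude_circle_third_design:
  "hybrid_design_with 2 (1/4) (latitude_circle (1/3)) {south_pole}"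
proof (rule hybrid_design_latitude_circle)
  fix i j k :: nat
  assume ijk: "i + j + k \<le> 2"
  define r :: real where "r = sqrt (1 - (1/3)\<^sup>2)"
  have r: "r * r = 8/9" by (simp add: r_def power2_eq_square)
  from ijk have k: "k = 0 \<or> k = 1 \<or> k = 2" by linarith
  from ijk consider "i = 0" "j = 0" | "i = 2" "j = 0" | "i = 0" "j = 2" | "i = 1" | "j = 1"
    by linarith
  then show "1/4 / real (card {south_pole}) * (\<Sum>x\<in>{south_pole}. monomial i j k x)
      + (1 - 1/4) * (sqrt (1 - (1/3)\<^sup>2) ^ (i + j) * (1/3) ^ k * circle_mean i j)
    = (if odd i \<or> odd j \<or> odd k then 0 else if i + j + k = 0 then 1 else 1/3)"
    unfolding r_def[symmetric] using k ijk
    by cases (elim disjE, simp_all add: south_pole_def pole_monomial circle_mean_def r power2_eq_square)+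
qed (use poles_in_S2 in auto)

lemma equator_design:
  "hybrid_design_with 3 (1/3) (latitude_circle 0) {north_pole, south_pole}"
proof (rule hybrid_design_latitude_circle)
  fix i j k :: nat
  assume ijk: "i + j + k \<le> 3"
  have "north_pole \<noteq> south_pole"
    by (simp add: north_pole_def south_pole_def vec_eq_iff forall_3)
  then have poles: "1/3 / real (card {north_pole, south_pole}) * (\<Sum>x\<in>{north_pole, south_pole}. monomial i j k x)
      = (if i + j = 0 \<and> even k then 1/3 else 0)"
    by (simp add: north_pole_def south_pole_def pole_monomial)
  from ijk have k: "k = 0 \<or> k = 1 \<or> k = 2 \<or> k = 3" by linarith
  from ijk consider "i = 0" "j = 0" | "i = 2" "j = 0" | "i = 0" "j = 2" | "i = 1" | "j = 1" | "i = 3" | "j = 3"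
    by linarith
  then show "1/3 / real (card {north_pole, south_pole}) * (\<Sum>x\<in>{north_pole, south_pole}. monomial i j k x)
      + (1 - 1/3) * (sqrt (1 - 0\<^sup>2) ^ (i + j) * 0 ^ k * circle_mean i j)
    = (if odd i \<or> odd j \<or> odd k then 0 else if i + j + k = 0 then 1 else 1/3)"
    unfolding poles using k ijk by cases (elim disjE, simp_all add: circle_mean_def)+
qed (use poles_in_S2 in auto)

section \<open>Geodesic triangles\<close>

text \<open>
  Moving the origin of the angle to the midpoint \<open>M\<close> makes the parameter interval symmetric, so that
  odd moments cancel. The unit tangent at \<open>x\<close> is \<open>D\<close> turned back by the angle \<open>\<phi>\<close>, namely
  \<open>sin \<phi> M + cos \<phi> D\<close>. The form with \<open>0 + _\<close> and \<open>+ (- \<phi>)\<close> matches the general circular arc.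
\<close>
lemma geodesic_arc_centered:
  fixes M D :: "real^3"
  assumes orth: "M \<bullet> D = 0" "norm M = 1" "norm D = 1" and \<phi>: "0 < \<phi>" "\<phi> < pi/2"
    and xy: "x = cos \<phi> *\<^sub>R M - sin \<phi> *\<^sub>R D" "y = cos \<phi> *\<^sub>R M + sin \<phi> *\<^sub>R D"
  shows "geodesic_arc x y =
    (\<lambda>t. 0 + cos (2 * \<phi> * t + (- \<phi>)) *\<^sub>R M + sin (2 * \<phi> * t + (- \<phi>)) *\<^sub>R D)"
proof
  fix t
  have MD: "M \<bullet> M = 1" "D \<bullet> D = 1" "D \<bullet> M = 0"
    using orth by (auto simp: dot_square_norm inner_commute)
  have "x \<bullet> y = cos (2 * \<phi>)"
    unfolding xy cos_double
    by (simp add: inner_add_left inner_add_right inner_diff_left inner_diff_right MD orth power2_eq_square)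
  then have c: "x \<bullet> y = cos (2 * \<phi>)" "arccos (x \<bullet> y) = 2 * \<phi>"
    using \<phi> by (simp_all add: arccos_cos)
  define e where "e = sin \<phi> *\<^sub>R M + cos \<phi> *\<^sub>R D"
  have "norm e = 1"
    using norm_circular[of D M 1 \<phi>] orth by (simp add: e_def inner_commute add.commute)
  have "0 < sin (2 * \<phi>)" using \<phi> by (intro sin_gt_zero) auto
  have "y - (x \<bullet> y) *\<^sub>R x = (cos \<phi> * (1 - cos (2 * \<phi>))) *\<^sub>R M + (sin \<phi> * (1 + cos (2 * \<phi>))) *\<^sub>R D"
    unfolding c(1) unfolding xy by (simp add: algebra_simps)
  also have "cos \<phi> * (1 - cos (2 * \<phi>)) = sin (2 * \<phi>) * sin \<phi>"
    by (simp add: cos_double_sin sin_double power2_eq_square)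
  also have "sin \<phi> * (1 + cos (2 * \<phi>)) = sin (2 * \<phi>) * cos \<phi>"
    by (simp add: cos_double_cos sin_double power2_eq_square)
  finally have "y - (x \<bullet> y) *\<^sub>R x = sin (2 * \<phi>) *\<^sub>R e"
    by (simp add: e_def scaleR_add_right)
  then have "sgn (y - (x \<bullet> y) *\<^sub>R x) = e"
    using \<open>norm e = 1\<close> \<open>0 < sin (2 * \<phi>)\<close> by (simp add: sgn_div_norm)
  then have "geodesic_arc x y t = cos (2 * \<phi> * t) *\<^sub>R x + sin (2 * \<phi> * t) *\<^sub>R e"
    unfolding geodesic_arc_def c(2) by (simp add: mult.commute)
  also have "\<dots> = cos (2 * \<phi> * t - \<phi>) *\<^sub>R M + sin (2 * \<phi> * t - \<phi>) *\<^sub>R D"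
    unfolding xy e_def cos_diff sin_diff by (simp add: algebra_simps)
  finally show "geodesic_arc x y t =
      0 + cos (2 * \<phi> * t + (- \<phi>)) *\<^sub>R M + sin (2 * \<phi> * t + (- \<phi>)) *\<^sub>R D"
    by simp
qed

definition centered_arc :: "real \<Rightarrow> real^3 \<Rightarrow> real^3 \<Rightarrow> real^3 \<Rightarrow> real^3 \<Rightarrow> bool"
  where "centered_arc \<phi> M D x y \<longleftrightarrow> M \<bullet> D = 0 \<and> norm M = 1 \<and> norm D = 1 \<and>
    x = cos \<phi> *\<^sub>R M - sin \<phi> *\<^sub>R D \<and> y = cos \<phi> *\<^sub>R M + sin \<phi> *\<^sub>R D"

lemma centered_arc_in_S2:
  assumes "centered_arc \<phi> M D x y"
  shows "x \<in> S2" "y \<in> S2"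
  using assms norm_circular[of M D 1 \<phi>] norm_circular[of M "- D" 1 \<phi>]
  by (simp_all add: centered_arc_def)

lemma closed_curve_geodesic_cycle:
  assumes \<phi>: "0 < \<phi>" "\<phi> < pi/2"
    and arcs: "centered_arc \<phi> M1 D1 x1 x2" "centered_arc \<phi> M2 D2 x2 x3" "centered_arc \<phi> M3 D3 x3 x1"
  shows "closed_curve_on_S2 (geodesic_cycle x1 x2 x3)"
proof -
  have arc: "path (geodesic_arc x y) \<and> path_image (geodesic_arc x y) \<subseteq> S2 \<and> piecewise_smooth (geodesic_arc x y)
      \<and> pathstart (geodesic_arc x y) = x \<and> pathfinish (geodesic_arc x y) = y"
    if "centered_arc \<phi> M D x y" for M D x y
  proof -
    have g: "geodesic_arc x y = (\<lambda>t. 0 + cos (2 * \<phi> * t + (- \<phi>)) *\<^sub>R M + sin (2 * \<phi> * t + (- \<phi>)) *\<^sub>R D)"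
      using that \<phi> by (intro geodesic_arc_centered) (auto simp: centered_arc_def)
    have "path (geodesic_arc x y)"
      unfolding path_def g by (intro continuous_intros)
    moreover have "path_image (geodesic_arc x y) \<subseteq> S2"
      unfolding path_image_def g using that norm_circular[of M D 1] by (auto simp: centered_arc_def)
    moreover have "piecewise_smooth (geodesic_arc x y)"
      unfolding g by (intro piecewise_smooth_if_smooth smooth_on_interval_circular)
    ultimately show ?thesis
      using geodesic_arc_endpoints centered_arc_in_S2[OF that] by blast
  qed
  show ?thesis
    unfolding closed_curve_on_S2_def geodesic_cycle_def
    using arc[OF arcs(1)] arc[OF arcs(2)] arc[OF arcs(3)]
    by (auto intro!: path_join_imp piecewise_smooth_join simp: path_image_join)
qed

lemma has_arclength_integral_geodesic_cycle:
  assumes \<phi>: "0 < \<phi>" "\<phi> < pi/2"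
    and arcs: "centered_arc \<phi> M1 D1 x1 x2" "centered_arc \<phi> M2 D2 x2 x3" "centered_arc \<phi> M3 D3 x3 x1"
    and int: "((\<lambda>u. p (cos u *\<^sub>R M1 + sin u *\<^sub>R D1)) has_integral I1) {-\<phi>..\<phi>}"
      "((\<lambda>u. p (cos u *\<^sub>R M2 + sin u *\<^sub>R D2)) has_integral I2) {-\<phi>..\<phi>}"
      "((\<lambda>u. p (cos u *\<^sub>R M3 + sin u *\<^sub>R D3)) has_integral I3) {-\<phi>..\<phi>}"
  shows "has_arclength_integral (geodesic_cycle x1 x2 x3) p (I1 + (I2 + I3))"
proof -
  have arc: "piecewise_smooth (geodesic_arc x y) \<and> has_arclength_integral (geodesic_arc x y) p I
      \<and> pathstart (geodesic_arc x y) = x \<and> pathfinish (geodesic_arc x y) = y"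
    if "centered_arc \<phi> M D x y" "((\<lambda>u. p (cos u *\<^sub>R M + sin u *\<^sub>R D)) has_integral I) {-\<phi>..\<phi>}" for M D x y I
  proof -
    have g: "geodesic_arc x y = (\<lambda>t. 0 + cos (2 * \<phi> * t + (- \<phi>)) *\<^sub>R M + sin (2 * \<phi> * t + (- \<phi>)) *\<^sub>R D)"
      using that(1) \<phi> by (intro geodesic_arc_centered) (auto simp: centered_arc_def)
    have "has_arclength_integral (geodesic_arc x y) p (1 * I)"
      unfolding g using that \<phi> by (intro has_arclength_integral_circular) (auto simp: centered_arc_def)
    moreover have "piecewise_smooth (geodesic_arc x y)"
      unfolding g by (intro piecewise_smooth_if_smooth smooth_on_interval_circular)
    ultimately show ?thesis
      using geodesic_arc_endpoints centered_arc_in_S2[OF that(1)] by simp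
  qed
  show ?thesis
    unfolding geodesic_cycle_def
    using arc[OF arcs(1) int(1)] arc[OF arcs(2) int(2)] arc[OF arcs(3) int(3)]
    by (auto intro!: has_arclength_integral_join piecewise_smooth_join)
qed

lemma has_integral_arc_moments:
  fixes \<phi> :: real
  assumes "0 \<le> \<phi>"
  shows "((\<lambda>u. 1) has_integral 2 * \<phi>) {-\<phi>..\<phi>}"
    and "((\<lambda>u. cos u * m + sin u * d) has_integral 2 * sin \<phi> * m) {-\<phi>..\<phi>}"
    and "((\<lambda>u. (cos u * m + sin u * d) * (cos u * m' + sin u * d')) has_integral
      (\<phi> + sin \<phi> * cos \<phi>) * (m * m') + (\<phi> - sin \<phi> * cos \<phi>) * (d * d')) {-\<phi>..\<phi>}"
proof -
  have ftc: "(f has_integral F \<phi> - F (-\<phi>)) {-\<phi>..\<phi>}"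
    if "\<And>u. (F has_real_derivative f u) (at u)" for F f :: "real \<Rightarrow> real"
    using that assms
    by (intro fundamental_theorem_of_calculus)
      (auto simp flip: has_real_derivative_iff_has_vector_derivative intro: has_field_derivative_at_within)
  show "((\<lambda>u. 1) has_integral 2 * \<phi>) {-\<phi>..\<phi>}"
    using ftc[of "\<lambda>u. u" "\<lambda>u. 1"] by simp
  have "((\<lambda>u. sin u * m - cos u * d) has_real_derivative cos u * m + sin u * d) (at u)" for u
    by (rule derivative_eq_intros refl | simp)+
  from ftc[OF this] show "((\<lambda>u. cos u * m + sin u * d) has_integral 2 * sin \<phi> * m) {-\<phi>..\<phi>}"
    by (simp add: mult_ac)
  have "((\<lambda>u. (u + sin u * cos u) / 2 * (m * m') + (u - sin u * cos u) / 2 * (d * d')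
        + (sin u)\<^sup>2 / 2 * (m * d' + d * m')) has_real_derivative
      (1 + (cos u * cos u - sin u * sin u)) / 2 * (m * m') + (1 - (cos u * cos u - sin u * sin u)) / 2 * (d * d')
        + sin u * cos u * (m * d' + d * m')) (at u)" for u
    by (auto intro!: derivative_eq_intros simp: field_simps)
  moreover have "(1 + (cos u * cos u - sin u * sin u)) / 2 * (m * m') + (1 - (cos u * cos u - sin u * sin u)) / 2 * (d * d')
        + sin u * cos u * (m * d' + d * m') = (cos u * m + sin u * d) * (cos u * m' + sin u * d')" for u
  proof -
    have "sin u * sin u = 1 - cos u * cos u"
      using sin_squared_eq[of u] unfolding power2_eq_square .
    then have *: "(1 + (cos u * cos u - sin u * sin u)) / 2 = cos u * cos u"
      "(1 - (cos u * cos u - sin u * sin u)) / 2 = sin u * sin u"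
      by (simp_all del: sin_cos_squared_add3)
    show ?thesis unfolding * by (simp add: algebra_simps)
  qed
  ultimately have *: "((\<lambda>u. (u + sin u * cos u) / 2 * (m * m') + (u - sin u * cos u) / 2 * (d * d')
        + (sin u)\<^sup>2 / 2 * (m * d' + d * m')) has_real_derivative
      (cos u * m + sin u * d) * (cos u * m' + sin u * d')) (at u)" for u
    by simp
  show "((\<lambda>u. (cos u * m + sin u * d) * (cos u * m' + sin u * d')) has_integral
      (\<phi> + sin \<phi> * cos \<phi>) * (m * m') + (\<phi> - sin \<phi> * cos \<phi>) * (d * d')) {-\<phi>..\<phi>}"
    by (rule has_integral_eq_rhs[OF ftc[OF *]]) (simp add: field_simps)
qed

text \<open>
  The last equation is the condition \<open>2 A + 3 B = 1\<close> on the means of \<open>z\<close> and \<open>z\<^sup>2\<close> along the triangle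
  with half edge length \<open>\<phi>\<close> and midpoints at height \<open>Z\<close>. The relation between \<open>Z\<close> and \<open>\<phi>\<close> comes from
  the right-angled spherical triangle formed by the pole, a vertex and an edge midpoint, whose angle
  at the pole is \<open>\<pi>/3\<close>: the opposite side \<open>\<phi>\<close> satisfies \<open>tan \<phi> = sqrt (1 - Z\<^sup>2) tan (\<pi>/3)\<close>.
\<close>
lemma exists_triangle_height:
  obtains \<phi> Z :: real
  where "0 < \<phi>" "\<phi> < pi/3" "0 < Z" "Z\<^sup>2 = 1 - (tan \<phi>)\<^sup>2 / 3"
    "2 * (sin \<phi> * Z / \<phi>) + 3 * ((\<phi> + sin \<phi> * cos \<phi>) * Z\<^sup>2 / (2 * \<phi>)) = 1"
proof -
  define Z where "Z \<phi> = sqrt (1 - (tan \<phi>)\<^sup>2 / 3)" for \<phi> :: real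
  define F where "F \<phi> = 2 * (sin \<phi> * Z \<phi> / \<phi>) + 3 * ((\<phi> + sin \<phi> * cos \<phi>) * (Z \<phi>)\<^sup>2 / (2 * \<phi>))" for \<phi>
  have cos_pos: "0 < cos \<phi>" if "\<phi> \<in> {pi/6..pi/3}" for \<phi>
  proof (rule cos_gt_zero)
    have "pi/6 \<le> \<phi>" "\<phi> \<le> pi/3" using that by auto
    then show "0 < \<phi>" "\<phi> < pi/2" using pi_gt_zero by linarith+
  qed
  have pos: "0 < \<phi>" if "\<phi> \<in> {pi/6..pi/3}" for \<phi>
  proof -
    have "pi/6 \<le> \<phi>" using that by auto
    then show ?thesis using pi_gt_zero by linarith
  qed
  have nz: "\<phi> \<noteq> 0" "cos \<phi> \<noteq> 0" if "\<phi> \<in> {pi/6..pi/3}" for \<phi>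
    using cos_pos[OF that] pos[OF that] by auto
  have cont: "continuous_on {pi/6..pi/3} F"
    unfolding F_def Z_def
    by (intro continuous_intros) (simp_all add: nz)
  have right: "F (pi/3) = 0"
    by (simp add: F_def Z_def tan_60)
  have left: "1 \<le> F (pi/6)"
  proof -
    have Z: "(Z (pi/6))\<^sup>2 = 8/9" "0 \<le> Z (pi/6)"
      by (auto simp: Z_def tan_30 power_divide)
    (* The term with Z squared is already at least 4/3. *)
    have "1 \<le> 3 * (8/9) / (2 :: real)" by simp
    also have "\<dots> \<le> 3 * ((pi/6 + sin (pi/6) * cos (pi/6)) * (8/9) / (2 * (pi/6)))"
      using pi_gt_zero by (simp add: sin_30 cos_30 field_simps)
    also have "\<dots> \<le> F (pi/6)"
      unfolding F_def Z using Z(2) pi_gt_zero by (simp add: sin_30)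
    finally show ?thesis .
  qed
  have "\<exists>\<phi>. pi/6 \<le> \<phi> \<and> \<phi> \<le> pi/3 \<and> F \<phi> = 1"
    by (rule IVT2'[OF _ left _ cont]) (use right pi_gt_zero in auto)
  then obtain \<phi> where \<phi>: "pi/6 \<le> \<phi>" "\<phi> \<le> pi/3" "F \<phi> = 1" by blast
  then have lt: "\<phi> < pi/3" using right by (cases "\<phi> = pi/3") auto
  have "0 < \<phi>" using \<phi>(1) pi_gt_zero by linarith
  have "tan \<phi> < tan (pi/3)" using \<open>0 < \<phi>\<close> lt pi_gt_zero by (intro tan_monotone) auto
  moreover have "0 < tan \<phi>" using \<open>0 < \<phi>\<close> lt pi_gt_zero by (intro tan_gt_zero) auto
  ultimately have "(tan \<phi>)\<^sup>2 < (sqrt 3)\<^sup>2" by (intro power_strict_mono) (auto simp: tan_60)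
  then have "0 < 1 - (tan \<phi>)\<^sup>2 / 3" by simp
  then have "0 < Z \<phi>" "(Z \<phi>)\<^sup>2 = 1 - (tan \<phi>)\<^sup>2 / 3" by (simp_all add: Z_def)
  with \<open>0 < \<phi>\<close> lt \<phi>(3) show ?thesis by (intro that[of \<phi> "Z \<phi>"]) (auto simp: F_def)
qed

text \<open>
  The parameter is \<open>\<phi>\<close>; the polar distance \<open>a\<close> of the vertices is recovered from
  \<open>sin a = 2 sin \<phi> / sqrt 3\<close> (the horizontal chord of an edge has length \<open>2 sin \<phi> = sqrt 3 sin a\<close>) and
  \<open>cos a = cos \<phi> Z\<close>. The horizontal parts of the three midpoints, and likewise the three directions,
  differ by rotations through \<open>2 \<pi> / 3\<close>, so their sums vanish and the sums of their squares are isotropic.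
\<close>
lemma geodesic_triangle_design:
  "\<exists>a. 0 < a \<and> a < pi / 2 \<and>
    hybrid_design 2
      (geodesic_cycle
        (vector [sin a, 0, cos a])
        (vector [- (1/2) * sin a, sqrt 3 / 2 * sin a, cos a])
        (vector [- (1/2) * sin a, - (sqrt 3 / 2) * sin a, cos a]))
      {south_pole}"
proof -
  obtain \<phi> Z :: real where \<phi>: "0 < \<phi>" "\<phi> < pi/3" and Z: "0 < Z" "Z\<^sup>2 = 1 - (tan \<phi>)\<^sup>2 / 3"
    and height: "2 * (sin \<phi> * Z / \<phi>) + 3 * ((\<phi> + sin \<phi> * cos \<phi>) * Z\<^sup>2 / (2 * \<phi>)) = 1"
    by (rule exists_triangle_height)
  have \<phi>2: "\<phi> < pi/2" using \<phi> by linarith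
  have sc: "0 < sin \<phi>" "0 < cos \<phi>" using \<phi> \<phi>2 by (auto intro: sin_gt_zero cos_gt_zero)
  define s c where "s = sin \<phi>" and "c = cos \<phi>"
  (* The distance of the edge midpoints from the z-axis. *)
  define W where "W = tan \<phi> / sqrt 3"
  have sc1: "s\<^sup>2 + c\<^sup>2 = 1" by (simp add: s_def c_def)
  have ZW: "W\<^sup>2 + Z\<^sup>2 = 1" using Z by (simp add: W_def power_divide)
  have cW: "c * W = s / sqrt 3" using sc by (simp add: W_def tan_def c_def s_def)
  have Z2: "Z\<^sup>2 = 1 - W\<^sup>2" using ZW by simp
  have "(c * Z)\<^sup>2 + (2 * s / sqrt 3)\<^sup>2 = c\<^sup>2 * (1 - W\<^sup>2) + 4 * (s / sqrt 3)\<^sup>2"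
    unfolding Z2[symmetric] by (simp add: power_mult_distrib power_divide)
  also have "\<dots> = c\<^sup>2 + 3 * (s / sqrt 3)\<^sup>2"
    unfolding cW[symmetric] by (simp add: power_mult_distrib algebra_simps)
  also have "\<dots> = 1" using sc1 by (simp add: power_divide)
  finally obtain a where a: "0 \<le> a" "a \<le> pi/2" "c * Z = cos a" "2 * s / sqrt 3 = sin a"
    using sincos_total_pi_half[of "c * Z" "2 * s / sqrt 3"] sc Z by (auto simp: s_def c_def)
  have "0 < cos a" "0 < sin a"
    using sc Z(1) unfolding a(3,4)[symmetric] s_def c_def by simp_all
  then have "a \<noteq> pi/2" "a \<noteq> 0"
    by (metis cos_pi_half less_irrefl, metis sin_zero less_irrefl)
  with a(1,2) have a_strict: "0 < a" "a < pi/2" by linarith+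
  define x1 x2 x3 :: "real^3" where "x1 = vector [sin a, 0, cos a]"
    and "x2 = vector [- (1/2) * sin a, sqrt 3 / 2 * sin a, cos a]"
    and "x3 = vector [- (1/2) * sin a, - (sqrt 3 / 2) * sin a, cos a]"
  define M1 M2 M3 :: "real^3" where "M1 = vector [W / 2, sqrt 3 / 2 * W, Z]"
    and "M2 = vector [- W, 0, Z]" and "M3 = vector [W / 2, - (sqrt 3 / 2) * W, Z]"
  define D1 D2 D3 :: "real^3" where "D1 = vector [- (sqrt 3 / 2), 1/2, 0]"
    and "D2 = vector [0, -1, 0]" and "D3 = vector [sqrt 3 / 2, 1/2, 0]"
  note MD = M1_def M2_def M3_def D1_def D2_def D3_def
  have ss: "sqrt 3 * (sqrt 3 * x) = 3 * x" for x :: real by (simp flip: mult.assoc)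
  have q: "s = sqrt 3 * (c * W)" unfolding cW by simp
  have sina: "sin a = 2 * (c * W)" unfolding cW a(4)[symmetric] by simp
  have arcs: "centered_arc \<phi> M1 D1 x1 x2" "centered_arc \<phi> M2 D2 x2 x3" "centered_arc \<phi> M3 D3 x3 x1"
    unfolding centered_arc_def s_def[symmetric] c_def[symmetric] x1_def x2_def x3_def MD sina a(3)[symmetric]
    using ZW q
    by (auto simp: inner_vec_def sum_3 norm_vec3 vec_eq_iff forall_3 power_mult_distrib power_divide ss algebra_simps)
  define P Q where "P = \<phi> + s * c" and "Q = \<phi> - s * c"
  have moment1: "has_arclength_integral (geodesic_cycle x1 x2 x3) (\<lambda>v. v$n)
      (2 * s * (M1$n + M2$n + M3$n))" for n
    using has_arclength_integral_geodesic_cycle[OF \<phi>(1) \<phi>2 arcs, of "\<lambda>v. v$n"]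
      has_integral_arc_moments(2)[of \<phi>] \<phi>
    by (simp add: s_def distrib_left add.assoc)
  have moment2: "has_arclength_integral (geodesic_cycle x1 x2 x3) (\<lambda>v. v$n * v$m)
      (P * (M1$n * M1$m + M2$n * M2$m + M3$n * M3$m) + Q * (D1$n * D1$m + D2$n * D2$m + D3$n * D3$m))" for n m
  proof -
    have "has_arclength_integral (geodesic_cycle x1 x2 x3) (\<lambda>v. v$n * v$m)
      ((P * (M1$n * M1$m) + Q * (D1$n * D1$m)) + ((P * (M2$n * M2$m) + Q * (D2$n * D2$m)) +
       (P * (M3$n * M3$m) + Q * (D3$n * D3$m))))"
      using \<phi> unfolding P_def Q_def s_def c_def
      by (intro has_arclength_integral_geodesic_cycle[OF \<phi>(1) \<phi>2 arcs])
        (simp_all add: has_integral_arc_moments(3))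
    then show ?thesis by (simp add: algebra_simps)
  qed
  have moment0: "has_arclength_integral (geodesic_cycle x1 x2 x3) (\<lambda>v. 1) (6 * \<phi>)"
  proof -
    have "((\<lambda>u. 1) has_integral 2 * \<phi>) {-\<phi>..\<phi>}"
      using \<phi> by (intro has_integral_arc_moments(1)) simp
    from has_arclength_integral_geodesic_cycle[OF \<phi>(1) \<phi>2 arcs this this this] show ?thesis
      by simp
  qed
  (* Unnormalized moments along the whole cycle, whose length is 6 \<phi>. *)
  define I where "I i j k = (if odd i \<or> odd j then 0 else if i + j = 2 then 3/2 * (P * W\<^sup>2 + Q)
    else if k = 0 then 6 * \<phi> else if k = 1 then 6 * s * Z else 3 * P * Z\<^sup>2)" for i j k :: nat
  have cases: thesis if "i + j + k \<le> 2"
    "i = 0 \<Longrightarrow> j = 0 \<Longrightarrow> k = 0 \<Longrightarrow> thesis" "i = 0 \<Longrightarrow> j = 0 \<Longrightarrow> k = 1 \<Longrightarrow> thesis" "i = 0 \<Longrightarrow> j = 0 \<Longrightarrow> k = 2 \<Longrightarrow> thesis"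
    "i = 1 \<Longrightarrow> j = 0 \<Longrightarrow> k = 0 \<Longrightarrow> thesis" "i = 1 \<Longrightarrow> j = 0 \<Longrightarrow> k = 1 \<Longrightarrow> thesis" "i = 1 \<Longrightarrow> j = 1 \<Longrightarrow> k = 0 \<Longrightarrow> thesis"
    "i = 0 \<Longrightarrow> j = 1 \<Longrightarrow> k = 0 \<Longrightarrow> thesis" "i = 0 \<Longrightarrow> j = 1 \<Longrightarrow> k = 1 \<Longrightarrow> thesis" "i = 2 \<Longrightarrow> j = 0 \<Longrightarrow> k = 0 \<Longrightarrow> thesis"
    "i = 0 \<Longrightarrow> j = 2 \<Longrightarrow> k = 0 \<Longrightarrow> thesis" for i j k :: nat and thesis
  proof -
    have "i = 0 \<or> i = 1 \<or> i = 2" "j = 0 \<or> j = 1 \<or> j = 2" "k = 0 \<or> k = 1 \<or> k = 2"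
      using that(1) by linarith+
    then show ?thesis
      using that by (elim disjE) simp_all
  qed
  have moments: "has_arclength_integral (geodesic_cycle x1 x2 x3) (monomial i j k) (I i j k)"
    if "i + j + k \<le> 2" for i j k
    using that
  proof (rule cases)
    assume "i = 0" "j = 0" "k = 0"
    then show ?thesis using moment0 by (simp add: monomial_def[abs_def] I_def)
  next
    assume "i = 0" "j = 0" "k = 1"
    then show ?thesis using moment1[of 3] by (simp add: monomial_def[abs_def] I_def MD mult_ac)
  next
    assume "i = 0" "j = 0" "k = 2"
    then show ?thesis using moment2[of 3 3] by (simp add: monomial_def[abs_def] I_def MD power2_eq_square mult_ac)
  next
    assume "i = 1" "j = 0" "k = 0"
    then show ?thesis using moment1[of 1] by (simp add: monomial_def[abs_def] I_def MD mult_ac)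
  next
    assume "i = 1" "j = 0" "k = 1"
    then show ?thesis using moment2[of 1 3] by (simp add: monomial_def[abs_def] I_def MD mult_ac)
  next
    assume "i = 1" "j = 1" "k = 0"
    then show ?thesis using moment2[of 1 2] by (simp add: monomial_def[abs_def] I_def MD mult_ac)
  next
    assume "i = 0" "j = 1" "k = 0"
    then show ?thesis using moment1[of 2] by (simp add: monomial_def[abs_def] I_def MD mult_ac)
  next
    assume "i = 0" "j = 1" "k = 1"
    then show ?thesis using moment2[of 2 3] by (simp add: monomial_def[abs_def] I_def MD mult_ac)
  next
    assume "i = 2" "j = 0" "k = 0"
    then show ?thesis using moment2[of 1 1]
      by (simp add: monomial_def[abs_def] I_def MD power2_eq_square ss algebra_simps add_divide_distrib)
  next
    assume "i = 0" "j = 2" "k = 0"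
    then show ?thesis using moment2[of 2 2]
      by (simp add: monomial_def[abs_def] I_def MD power2_eq_square ss algebra_simps add_divide_distrib)
  qed
  (* The means of z and of its square along the cycle. *)
  define A where "A = s * Z / \<phi>"
  define B where "B = P * Z\<^sup>2 / (2 * \<phi>)"
  have A: "0 < A" using sc Z \<phi> by (simp add: A_def s_def)
  have AB: "2 * A + 3 * B = 1" using height by (simp add: A_def B_def P_def s_def c_def)
  have "3/2 * (P * W\<^sup>2 + Q) = 3 * \<phi> * (1 - B)"
  proof -
    have "3 * \<phi> * (1 - B) = 3 * \<phi> - 3/2 * (P * Z\<^sup>2)"
      using \<phi>(1) by (simp add: B_def field_simps)
    then show ?thesis
      unfolding Z2 by (simp add: P_def Q_def algebra_simps)
  qed
  moreover define mean where "mean i j k = (if odd i \<or> odd j then 0 else if i + j = 2 then (1 - B) / 2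
    else if k = 0 then 1 else if k = 1 then A else B)" for i j k :: nat
  ultimately have mean: "I i j k / (6 * \<phi>) = mean i j k" for i j k
    using \<phi>(1) by (auto simp: I_def A_def B_def)
  have "hybrid_design_with 2 (A / (1 + A)) (geodesic_cycle x1 x2 x3) {south_pole}"
  proof (rule hybrid_design_withI[OF closed_curve_geodesic_cycle[OF \<phi>(1) \<phi>2 arcs] _ _ _ _ moments])
    fix i j k :: nat
    assume ijk: "i + j + k \<le> 2"
    have B: "B = (1 - 2 * A) / 3" using AB by simp
    have A1: "1 + A \<noteq> 0" "1 - A / (1 + A) = 1 / (1 + A)" using A by (auto simp: field_simps)
    have "A / (1 + A) * monomial i j k south_pole + (1 - A / (1 + A)) * mean i j k
      = (A * monomial i j k south_pole + mean i j k) / (1 + A)"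
      unfolding A1(2) by (simp add: add_divide_distrib)
    also have "\<dots> = (\<integral>v. monomial i j k v \<partial>sphere_measure)"
      using ijk
      by (rule cases)
        (use A1(1) in \<open>simp_all add: sphere_moment south_pole_def pole_monomial mean_def B field_simps\<close>)
    finally show "A / (1 + A) / real (card {south_pole}) * (\<Sum>x\<in>{south_pole}. monomial i j k x)
        + (1 - A / (1 + A)) / I 0 0 0 * I i j k = (\<integral>v. monomial i j k v \<partial>sphere_measure)"
      by (simp add: I_def[of 0 0 0] flip: mean)
  qed (use A poles_in_S2 in auto)
  then show ?thesis
    using a_strict unfolding hybrid_design_def x1_def x2_def x3_def by blast
qed

theorem proposition4p3:
  shows "hybrid_design_with 2 (1/4) (latitude_circle (1/3)) {south_pole} \<and>
    (\<exists>a. 0 < a \<and> a < pi / 2 \<and>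
      hybrid_design 2
        (geodesic_cycle
          (vector [sin a, 0, cos a])
          (vector [- (1/2) * sin a, sqrt 3 / 2 * sin a, cos a])
          (vector [- (1/2) * sin a, - (sqrt 3 / 2) * sin a, cos a]))
        {south_pole}) \<and>
    hybrid_design_with 3 (1/3) (latitude_circle 0) {north_pole, south_pole}"
  using latitude_circle_third_design geodesic_triangle_design equator_design by blast

end
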